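(* Let $F$ be an Archimedean vector lattice. (1) If $F$ has an order dense and majorizing sublattice which has the projection property (PP), then $F$ has PP. (2) If $F$ has a super order dense and majorizing sublattice which has $\sigma$-PP, then $F$ has $\sigma$-PP.
   Context: A sublattice of a vector lattice is a linear subspace closed under the lattice operations. An ideal of a vector lattice $F$ is a linear subspace $J\subset F$ such that $|f|\le|e|$, $e\in J$, $f\in F$ imply $f\in J$. A band is an ideal that contains the supremum of any of its subsets whenever this supremum exists; a band is countably generated if it is the smallest band containing some countable set. An ideal $H$ in $F$ is a projection band if $F=H+H^d$, where $H^d=\{f\in F:|f|\wedge|h|=0\text{ for all }h\in H\}$. $F$ has PP if every band in $F$ is a projection band, and $\sigma$-PP if every countably generated band in $F$ is a projection band. A sublattice $E\subset F$ is order dense if for every $0<f\in F$ there is $e\in E$ with $0<e\le f$; super order dense if for every $f\in F_+$ there is a countable $G\subset E$ with $f=\bigvee G$ (supremum in $F$); majorizing if the smallest ideal of $F$ containing $E$ is $F$. *)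

theory Defs
  imports
    Complex_Main
    "HOL-Library.Lattice_Algebras"
    "HOL-Library.Lub_Glb"
    "HOL-Library.Set_Algebras"
    "HOL-Library.Countable_Set"
begin

class vector_lattice = ordered_real_vector + lattice_ab_group_add_abs

text \<open>
  The set \<open>L\<close> below is a vector lattice, given as a sublattice of the ambient type. All notions
  are relative to \<open>L\<close>: a sublattice is a vector lattice in its own right, and suprema of its
  subsets taken inside it (\<open>isLub L\<close>) may differ from those taken in the ambient lattice
  (\<open>isLub UNIV\<close>).
\<close>

definition archimedean_lattice :: "'a::vector_lattice set \<Rightarrow> bool" where
  "archimedean_lattice L \<longleftrightarrow>
     (\<forall>x\<in>L. \<forall>y\<in>L. 0 \<le> x \<longrightarrow> 0 \<le> y \<longrightarrow> (\<forall>n::nat. real n *\<^sub>R x \<le> y) \<longrightarrow> x = 0)"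

definition vector_sublattice :: "'a::vector_lattice set \<Rightarrow> 'a set \<Rightarrow> bool" where
  "vector_sublattice L E \<longleftrightarrow>
     E \<subseteq> L \<and> subspace E \<and> (\<forall>x\<in>E. \<forall>y\<in>E. sup x y \<in> E \<and> inf x y \<in> E)"

definition order_ideal :: "'a::vector_lattice set \<Rightarrow> 'a set \<Rightarrow> bool" where
  "order_ideal L J \<longleftrightarrow>
     J \<subseteq> L \<and> subspace J \<and> (\<forall>f\<in>L. \<forall>e\<in>J. \<bar>f\<bar> \<le> \<bar>e\<bar> \<longrightarrow> f \<in> J)"

definition band :: "'a::vector_lattice set \<Rightarrow> 'a set \<Rightarrow> bool" where
  "band L B \<longleftrightarrow> order_ideal L B \<and> (\<forall>A s. A \<subseteq> B \<and> isLub L A s \<longrightarrow> s \<in> B)"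

definition countably_generated_band :: "'a::vector_lattice set \<Rightarrow> 'a set \<Rightarrow> bool" where
  "countably_generated_band L B \<longleftrightarrow> (\<exists>C. countable C \<and> C \<subseteq> L \<and> B = band L hull C)"

definition disjoint_complement :: "'a::vector_lattice set \<Rightarrow> 'a set \<Rightarrow> 'a set" where
  "disjoint_complement L H = {f\<in>L. \<forall>h\<in>H. inf \<bar>f\<bar> \<bar>h\<bar> = 0}"

definition projection_band :: "'a::vector_lattice set \<Rightarrow> 'a set \<Rightarrow> bool" where
  "projection_band L H \<longleftrightarrow> order_ideal L H \<and> L = H + disjoint_complement L H"

definition PP :: "'a::vector_lattice set \<Rightarrow> bool" where
  "PP L \<longleftrightarrow> (\<forall>B. band L B \<longrightarrow> projection_band L B)"

definition sigma_PP :: "'a::vector_lattice set \<Rightarrow> bool" where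
  "sigma_PP L \<longleftrightarrow> (\<forall>B. countably_generated_band L B \<longrightarrow> projection_band L B)"

definition order_dense :: "'a::vector_lattice set \<Rightarrow> 'a set \<Rightarrow> bool" where
  "order_dense L E \<longleftrightarrow> (\<forall>f\<in>L. 0 < f \<longrightarrow> (\<exists>e\<in>E. 0 < e \<and> e \<le> f))"

definition super_order_dense :: "'a::vector_lattice set \<Rightarrow> 'a set \<Rightarrow> bool" where
  "super_order_dense L E \<longleftrightarrow> (\<forall>f\<in>L. 0 \<le> f \<longrightarrow> (\<exists>G\<subseteq>E. countable G \<and> isLub L G f))"

definition majorizing :: "'a::vector_lattice set \<Rightarrow> 'a set \<Rightarrow> bool" where
  "majorizing L E \<longleftrightarrow> order_ideal L hull E = L"

text \<open>
  The hulls above are intersections; the next two facts confirm that they are the smallest ideal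
  and the smallest band containing a given subset of \<open>L\<close>.
\<close>

lemma order_ideal_self: "subspace L \<Longrightarrow> order_ideal L L"
  by (auto simp: order_ideal_def)

lemma band_self: "subspace L \<Longrightarrow> band L L"
  by (auto simp: band_def order_ideal_self isLub_def leastP_def isUb_def)

lemma order_ideal_hull:
  assumes "subspace L" "C \<subseteq> L"
  shows "order_ideal L (order_ideal L hull C)"
proof -
  have "order_ideal L hull C \<subseteq> L"
    using assms by (intro hull_minimal order_ideal_self)
  moreover have "subspace (order_ideal L hull C)"
    unfolding hull_def by (rule subspace_Inter) (auto simp: order_ideal_def)
  moreover have "f \<in> order_ideal L hull C"
    if "f \<in> L" "e \<in> order_ideal L hull C" "\<bar>f\<bar> \<le> \<bar>e\<bar>" for f e
    using that unfolding hull_def order_ideal_def by blast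
  ultimately show ?thesis
    unfolding order_ideal_def by blast
qed

lemma band_hull:
  assumes "subspace L" "C \<subseteq> L"
  shows "band L (band L hull C)"
proof -
  have "band L hull C \<subseteq> L"
    using assms by (intro hull_minimal band_self)
  moreover have "subspace (band L hull C)"
    unfolding hull_def by (rule subspace_Inter) (auto simp: band_def order_ideal_def)
  moreover have "f \<in> band L hull C"
    if "f \<in> L" "e \<in> band L hull C" "\<bar>f\<bar> \<le> \<bar>e\<bar>" for f e
    using that unfolding hull_def band_def order_ideal_def by blast
  moreover have "s \<in> band L hull C" if "A \<subseteq> band L hull C" "isLub L A s" for A s
  proof -
    have "s \<in> B" if B: "band L B" "C \<subseteq> B" for B
      using B \<open>isLub L A s\<close> \<open>A \<subseteq> band L hull C\<close> hull_minimal[of C B "band L"]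
      unfolding band_def by blast
    then show ?thesis
      unfolding hull_def by blast
  qed
  ultimately show ?thesis
    unfolding band_def order_ideal_def by blast
qed

end

theory Submission
  imports Defs
begin

text \<open>
  Let \<open>E\<close> be an order dense majorizing sublattice of the Archimedean lattice \<open>F\<close> (the ambient
  type) and let \<open>B\<close> be a band in \<open>F\<close>. The sum \<open>B + B\<^sup>d\<close> is an ideal by Riesz decomposition, so,
  \<open>E\<close> being majorizing, \<open>F = B + B\<^sup>d\<close> follows as soon as \<open>E \<subseteq> B + B\<^sup>d\<close>.

  To split the elements of \<open>E\<close>, choose \<open>G \<subseteq> B \<inter> E\<close> so large that whatever is disjoint from \<open>G\<close> is
  already disjoint from \<open>B\<close>, and let \<open>D\<close> be the band generated by \<open>G\<close> inside \<open>E\<close>. If \<open>D\<close> is a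
  projection band in \<open>E\<close>, then \<open>E = D + D'\<close>, where \<open>D'\<close> is the disjoint complement within \<open>E\<close>.
  The elements of \<open>D'\<close> are disjoint from \<open>G\<close>, hence lie in \<open>B\<^sup>d\<close>. The elements of \<open>D\<close> lie in
  \<open>B\<^sup>d\<^sup>d\<close>: if some \<open>d \<in> D\<close> were not disjoint from some \<open>h \<in> B\<^sup>d\<close>, order density would provide
  \<open>e \<in> E\<close> with \<open>0 < e \<le> \<bar>d\<bar> \<and> \<bar>h\<bar>\<close>. This \<open>e\<close> is disjoint from \<open>G\<close>, so the disjoint complement of
  \<open>e\<close> within \<open>E\<close> is a band that contains \<open>G\<close>, hence \<open>D\<close>, and \<open>e\<close> is disjoint from \<open>d\<close>, which is
  absurd. Finally \<open>B\<^sup>d\<^sup>d = B\<close> because \<open>F\<close> is Archimedean.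

  For the projection property one takes \<open>G = B \<inter> E\<close>, which is large enough by order density. If
  \<open>B\<close> is generated by a countable set \<open>C\<close>, super order density writes every \<open>\<bar>c\<bar>\<close>, \<open>c \<in> C\<close>, as the
  supremum of countably many positive elements of \<open>E\<close>, and these together form a countable \<open>G\<close>.
  Working with disjoint complements throughout means that suprema in \<open>E\<close> never have to be compared
  with suprema in \<open>F\<close>.
\<close>

section \<open>Disjointness\<close>

lemma abs_eq_pprt_plus_pprt_neg:
  fixes x :: "'a::vector_lattice"
  shows "\<bar>x\<bar> = pprt x + pprt (- x)"
  by (simp add: abs_prts pprt_neg)

lemma pprt_le_abs:
  fixes x :: "'a::vector_lattice"
  shows "pprt x \<le> \<bar>x\<bar>"
  by (simp add: abs_eq_pprt_plus_pprt_neg)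

lemma inf_add_le:
  fixes x y z :: "'a::vector_lattice"
  assumes "0 \<le> x" "0 \<le> y" "0 \<le> z"
  shows "inf (x + y) z \<le> inf x z + inf y z"
proof -
  have "inf (x + y) z \<le> z + z"
    by (rule le_infI2) (use assms(3) in \<open>simp\<close>)
  moreover have "inf (x + y) z \<le> x + z" "inf (x + y) z \<le> z + y"
    using assms by (simp_all add: le_infI2 add_increasing add_increasing2)
  ultimately show ?thesis
    by (simp add: add_sup_inf_distribs add.commute)
qed

lemma disjoint_mono:
  fixes x y z :: "'a::vector_lattice"
  assumes "inf \<bar>x\<bar> \<bar>z\<bar> = 0" "\<bar>y\<bar> \<le> \<bar>x\<bar>"
  shows "inf \<bar>y\<bar> \<bar>z\<bar> = 0"
  using assms inf_mono[of "\<bar>y\<bar>" "\<bar>x\<bar>" "\<bar>z\<bar>" "\<bar>z\<bar>"]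
  by (intro order.antisym) simp_all

lemma disjoint_add:
  fixes x y z :: "'a::vector_lattice"
  assumes "inf \<bar>x\<bar> \<bar>z\<bar> = 0" "inf \<bar>y\<bar> \<bar>z\<bar> = 0"
  shows "inf \<bar>x + y\<bar> \<bar>z\<bar> = 0"
proof -
  have "inf \<bar>x + y\<bar> \<bar>z\<bar> \<le> inf (\<bar>x\<bar> + \<bar>y\<bar>) \<bar>z\<bar>"
    by (intro inf_mono abs_triangle_ineq order_refl)
  also have "\<dots> \<le> inf \<bar>x\<bar> \<bar>z\<bar> + inf \<bar>y\<bar> \<bar>z\<bar>"
    by (rule inf_add_le) simp_all
  finally show ?thesis
    using assms by (intro order.antisym) simp_all
qed

text \<open>
  Disjointness passes to sums and to smaller elements, so natural multiples of \<open>\<bar>x\<bar>\<close> suffice.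
\<close>

lemma disjoint_scaleR:
  fixes x z :: "'a::vector_lattice"
  assumes "inf \<bar>x\<bar> \<bar>z\<bar> = 0"
  shows "inf \<bar>c *\<^sub>R x\<bar> \<bar>z\<bar> = 0"
proof -
  have multiple: "inf \<bar>real m *\<^sub>R \<bar>x\<bar>\<bar> \<bar>z\<bar> = 0" for m
    by (induction m) (simp_all add: algebra_simps disjoint_add assms inf_absorb1)
  obtain n where n: "\<bar>c\<bar> \<le> real n"
    using real_arch_simple by blast
  have "c *\<^sub>R y \<le> real n *\<^sub>R \<bar>x\<bar>" if "y = x \<or> y = - x" for y
  proof -
    have y: "y \<le> \<bar>x\<bar>" "- y \<le> \<bar>x\<bar>"
      using that by (auto simp: abs_ge_self abs_ge_minus_self)
    have "c *\<^sub>R y \<le> \<bar>c\<bar> *\<^sub>R \<bar>x\<bar>"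
      using y scaleR_left_mono[of y "\<bar>x\<bar>" "\<bar>c\<bar>"] scaleR_left_mono[of "- y" "\<bar>x\<bar>" "\<bar>c\<bar>"]
      by (cases "0 \<le> c") simp_all
    also have "\<dots> \<le> real n *\<^sub>R \<bar>x\<bar>"
      by (intro scaleR_right_mono n) simp
    finally show ?thesis .
  qed
  from this[of x] this[of "- x"] have "\<bar>c *\<^sub>R x\<bar> \<le> real n *\<^sub>R \<bar>x\<bar>"
    by (simp add: abs_leI)
  moreover have "0 \<le> real n *\<^sub>R \<bar>x\<bar>"
    by (simp add: scaleR_nonneg_nonneg)
  ultimately show ?thesis
    using multiple[of n] disjoint_mono[of "real n *\<^sub>R \<bar>x\<bar>" z "c *\<^sub>R x"] by simp
qed

lemma not_disjoint_if_below:
  fixes e x :: "'a::vector_lattice"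
  assumes "0 < e" "e \<le> \<bar>x\<bar>"
  shows "inf \<bar>e\<bar> \<bar>x\<bar> \<noteq> 0"
  using assms by (simp add: inf_absorb1 less_imp_le)

lemma order_dense_not_disjoint:
  fixes x y :: "'a::vector_lattice"
  assumes "order_dense UNIV E" "inf \<bar>x\<bar> \<bar>y\<bar> \<noteq> 0"
  obtains e where "e \<in> E" "0 < e" "e \<le> \<bar>x\<bar>" "e \<le> \<bar>y\<bar>"
proof -
  have "0 < inf \<bar>x\<bar> \<bar>y\<bar>"
    using assms(2) by (simp add: order.strict_iff_order)
  with assms(1) obtain e where "e \<in> E" "0 < e" "e \<le> inf \<bar>x\<bar> \<bar>y\<bar>"
    unfolding order_dense_def by blast
  with that show thesis by simp
qed

section \<open>Ideals, bands and disjoint complements\<close>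

lemma vector_sublattice_UNIV: "vector_sublattice UNIV (UNIV :: 'a::vector_lattice set)"
  by (simp add: vector_sublattice_def)

lemma vector_sublattice_closed:
  assumes "vector_sublattice UNIV L" "x \<in> L"
  shows "\<bar>x\<bar> \<in> L" "pprt x \<in> L"
  using assms unfolding vector_sublattice_def
  by (simp_all add: abs_lattice pprt_def subspace_neg subspace_0)

lemma order_ideal_subspace: "order_ideal L J \<Longrightarrow> subspace J"
  by (simp add: order_ideal_def)

lemma order_ideal_UNIV_mem:
  "order_ideal UNIV J \<Longrightarrow> e \<in> J \<Longrightarrow> \<bar>f\<bar> \<le> \<bar>e\<bar> \<Longrightarrow> f \<in> J"
  by (auto simp: order_ideal_def)

text \<open>
  If \<open>s\<close> is the supremum of a set \<open>A\<close> disjoint from \<open>h\<close>, then \<open>s - (s\<^sup>+ \<and> \<bar>h\<bar>)\<close> is still an upper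
  bound of \<open>A\<close>, since the sum of the disjoint elements \<open>a\<^sup>+\<close> and \<open>s\<^sup>+ \<and> \<bar>h\<bar>\<close> is their supremum, which lies
  below \<open>s\<^sup>+\<close>. Hence \<open>s\<^sup>+ \<and> \<bar>h\<bar> = 0\<close>. For the negative part, \<open>s\<^sup>- \<le> a\<^sup>-\<close> for any \<open>a \<in> A\<close>. The argument takes place inside \<open>L\<close>, so it applies to suprema formed in a
  sublattice.
\<close>

lemma band_disjoint_complement:
  fixes L :: "'a::vector_lattice set"
  assumes L: "vector_sublattice UNIV L" and "H \<subseteq> L"
  shows "band L (disjoint_complement L H)"
proof -
  let ?D = "disjoint_complement L H"
  have infL: "inf x y \<in> L" if "x \<in> L" "y \<in> L" for x y
    using L that by (auto simp: vector_sublattice_def)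
  have "subspace L"
    using L by (auto simp: vector_sublattice_def)
  have "subspace ?D"
    unfolding subspace_def disjoint_complement_def
    using \<open>subspace L\<close>
    by (auto simp: subspace_0 subspace_add subspace_scale disjoint_add disjoint_scaleR inf_absorb1)
  then have ideal: "order_ideal L ?D"
    unfolding order_ideal_def disjoint_complement_def by (auto intro: disjoint_mono)
  have "s \<in> ?D" if "A \<subseteq> ?D" and s: "isLub L A s" for A s
  proof -
    have "s \<in> L" using s by (rule isLubD1a)
    have "inf \<bar>s\<bar> \<bar>h\<bar> = 0" if "h \<in> H" for h
    proof (cases "A = {}")
      case True
      \<comment> \<open>The supremum of the empty set is the least element of \<open>L\<close>, which must be \<open>0\<close>.\<close>
      have "s - \<bar>s\<bar> \<in> L"
        using \<open>subspace L\<close> \<open>s \<in> L\<close> vector_sublattice_closed[OF L] by (simp add: subspace_diff)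
      then have "isUb L A (s - \<bar>s\<bar>)"
        using True by (simp add: isUb_def setle_def)
      from isLub_le_isUb[OF s this] show ?thesis by (simp add: inf_absorb1)
    next
      case False
      define e where "e = inf (pprt s) \<bar>h\<bar>"
      have "h \<in> L" using \<open>h \<in> H\<close> \<open>H \<subseteq> L\<close> by blast
      have "0 \<le> e" by (simp add: e_def)
      have "e \<in> L"
        unfolding e_def using \<open>s \<in> L\<close> \<open>h \<in> L\<close> vector_sublattice_closed[OF L] by (simp add: infL)
      have "a \<le> s - e" if "a \<in> A" for a
      proof -
        have "a \<le> s" using s that by (rule isLubD2)
        have "inf \<bar>a\<bar> \<bar>h\<bar> = 0"
          using that \<open>A \<subseteq> ?D\<close> \<open>h \<in> H\<close> by (auto simp: disjoint_complement_def)
        moreover have "inf (pprt a) e \<le> inf \<bar>a\<bar> \<bar>h\<bar>"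
          by (intro inf_mono pprt_le_abs) (simp add: e_def)
        ultimately have "inf (pprt a) e = 0"
          using \<open>0 \<le> e\<close> by (intro order.antisym) simp_all
        then have "pprt a + e = sup (pprt a) e"
          using add_eq_inf_sup[of "pprt a" e] by simp
        also have "\<dots> \<le> pprt s"
          using \<open>a \<le> s\<close> by (simp add: e_def)
        finally have "pprt a + e + nprt a \<le> pprt s + nprt s"
          using \<open>a \<le> s\<close> by (intro add_mono) simp_all
        then show ?thesis
          using prts[of a] prts[of s] by (simp add: algebra_simps)
      qed
      then have "isUb L A (s - e)"
        using \<open>subspace L\<close> \<open>s \<in> L\<close> \<open>e \<in> L\<close> by (simp add: isUb_def setle_def subspace_diff)
      from isLub_le_isUb[OF s this] have "e \<le> 0" by simp
      with \<open>0 \<le> e\<close> have pos: "inf \<bar>pprt s\<bar> \<bar>h\<bar> = 0"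
        by (simp add: e_def order.antisym)
      obtain a where "a \<in> A" using False by blast
      then have "- s \<le> - a" using isLubD2[OF s] by simp
      then have "\<bar>pprt (- s)\<bar> \<le> \<bar>a\<bar>"
        using order_trans[OF pprt_mono pprt_le_abs[of "- a"]] by simp
      moreover have "inf \<bar>a\<bar> \<bar>h\<bar> = 0"
        using \<open>a \<in> A\<close> \<open>A \<subseteq> ?D\<close> \<open>h \<in> H\<close> by (auto simp: disjoint_complement_def)
      ultimately have neg: "inf \<bar>pprt (- s)\<bar> \<bar>h\<bar> = 0"
        by (blast intro: disjoint_mono)
      from disjoint_add[OF pos neg] show ?thesis
        by (simp add: abs_eq_pprt_plus_pprt_neg[symmetric])
    qed
    with \<open>s \<in> L\<close> show ?thesis by (simp add: disjoint_complement_def)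
  qed
  with ideal show ?thesis unfolding band_def by blast
qed

text \<open>
  For \<open>f\<close> in \<open>B\<^sup>d\<^sup>d\<close>, which may be taken positive, \<open>f\<close> is the supremum of the elements of \<open>B\<close>
  below it. Otherwise some upper bound \<open>u < f\<close> of these elements leaves a gap \<open>f - u > 0\<close> in \<open>B\<^sup>d\<^sup>d\<close>. The gap cannot be
  disjoint from \<open>B\<close>, so it dominates some \<open>c > 0\<close> in \<open>B\<close>, and then \<open>n c \<le> u\<close> implies
  \<open>(n + 1) c \<le> f\<close> and so \<open>(n + 1) c \<le> u\<close>, against the Archimedean property.
\<close>

lemma double_disjoint_complement_subset_band:
  fixes B :: "'a::vector_lattice set"
  assumes arch: "archimedean_lattice (UNIV :: 'a set)" and B: "band UNIV B"
  shows "disjoint_complement UNIV (disjoint_complement UNIV B) \<subseteq> B"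
proof
  let ?Bd = "disjoint_complement UNIV B"
  let ?Bdd = "disjoint_complement UNIV ?Bd"
  have idealB: "order_ideal UNIV B" using B by (simp add: band_def)
  note subB = order_ideal_subspace[OF idealB]
  have idealdd: "order_ideal UNIV ?Bdd"
    using band_disjoint_complement[OF vector_sublattice_UNIV, of ?Bd] by (simp add: band_def)
  fix f assume "f \<in> ?Bdd"
  define A where "A = {b\<in>B. b \<le> \<bar>f\<bar>}"
  have le_ub: "\<bar>f\<bar> \<le> v" if v: "\<And>b. b \<in> A \<Longrightarrow> b \<le> v" for v
  proof -
    define u where "u = inf v \<bar>f\<bar>"
    have u: "b \<le> u" if "b \<in> A" for b
      using that v by (simp add: u_def A_def)
    have "0 \<in> A" using subB by (simp add: A_def subspace_0)
    then have "0 \<le> u" by (rule u)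
    \<comment> \<open>The gap \<open>g\<close> turns out to be disjoint from \<open>B\<close> and from itself, hence zero.\<close>
    define g where "g = \<bar>f\<bar> - u"
    have "u \<le> \<bar>f\<bar>" by (simp add: u_def)
    then have "0 \<le> g" by (simp add: g_def)
    have "g \<le> \<bar>f\<bar>" using \<open>0 \<le> u\<close> by (simp add: g_def)
    with \<open>0 \<le> g\<close> have "g \<in> ?Bdd"
      using order_ideal_UNIV_mem[OF idealdd \<open>f \<in> ?Bdd\<close>] by simp
    have "inf \<bar>g\<bar> \<bar>b\<bar> = 0" if "b \<in> B" for b
    proof -
      define c where "c = inf \<bar>g\<bar> \<bar>b\<bar>"
      have "0 \<le> c" "\<bar>c\<bar> \<le> \<bar>b\<bar>" by (simp_all add: c_def)
      then have "c \<in> B" using order_ideal_UNIV_mem[OF idealB that] by blast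
      have "real n *\<^sub>R c \<le> \<bar>f\<bar>" for n
      proof (induction n)
        case 0
        show ?case by simp
      next
        case (Suc n)
        then have "real n *\<^sub>R c \<le> u"
          using subB \<open>c \<in> B\<close> by (intro u) (simp add: A_def subspace_scale)
        moreover have "c \<le> g" using \<open>0 \<le> g\<close> by (simp add: c_def)
        ultimately have "real n *\<^sub>R c + c \<le> u + g" by (rule add_mono)
        then show ?case by (simp add: g_def algebra_simps)
      qed
      with arch \<open>0 \<le> c\<close> have "c = 0"
        unfolding archimedean_lattice_def by (meson UNIV_I abs_ge_zero)
      then show ?thesis by (simp add: c_def)
    qed
    then have "g \<in> ?Bd" by (simp add: disjoint_complement_def)
    with \<open>g \<in> ?Bdd\<close> have "inf \<bar>g\<bar> \<bar>g\<bar> = 0"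
      unfolding disjoint_complement_def by blast
    then have "g = 0" by simp
    then have "\<bar>f\<bar> = u" unfolding g_def by (simp only: right_minus_eq)
    also have "u \<le> v" by (simp add: u_def)
    finally show ?thesis .
  qed
  then have "isLub UNIV A \<bar>f\<bar>"
    by (intro isLubI2) (auto simp: isUb_def setle_def setge_def A_def)
  moreover have "A \<subseteq> B" by (auto simp: A_def)
  ultimately have "\<bar>f\<bar> \<in> B" using B unfolding band_def by blast
  then show "f \<in> B" using order_ideal_UNIV_mem[OF idealB] by simp
qed

text \<open>
  Riesz decomposition: if \<open>0 \<le> f \<le> \<bar>a\<bar> + \<bar>b\<bar>\<close>, then \<open>f\<close> is the sum of \<open>f \<and> \<bar>a\<bar>\<close> and
  \<open>(f - \<bar>a\<bar>)\<^sup>+ \<le> \<bar>b\<bar>\<close>.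
\<close>

lemma order_ideal_sum:
  fixes I J :: "'a::vector_lattice set"
  assumes I: "order_ideal UNIV I" and J: "order_ideal UNIV J"
  shows "order_ideal UNIV (I + J)"
proof -
  have sub: "subspace (I + J)"
    using subspace_sums[OF order_ideal_subspace[OF I] order_ideal_subspace[OF J]]
    by (simp add: set_plus_def Bex_def conj_ac)
  have pos: "f \<in> I + J" if "a \<in> I" "b \<in> J" "0 \<le> f" "f \<le> \<bar>a\<bar> + \<bar>b\<bar>" for f a b
  proof -
    have "inf f \<bar>a\<bar> \<in> I"
      using order_ideal_UNIV_mem[OF I \<open>a \<in> I\<close>] \<open>0 \<le> f\<close> by simp
    moreover have "f - inf f \<bar>a\<bar> \<in> J"
    proof -
      have split: "f - inf f \<bar>a\<bar> = sup 0 (f - \<bar>a\<bar>)"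
        by (simp add: diff_inf_eq_sup add_sup_distrib_left)
      have "\<bar>f - inf f \<bar>a\<bar>\<bar> \<le> \<bar>b\<bar>"
        unfolding split using \<open>f \<le> \<bar>a\<bar> + \<bar>b\<bar>\<close> by (simp add: algebra_simps)
      then show ?thesis
        by (rule order_ideal_UNIV_mem[OF J \<open>b \<in> J\<close>])
    qed
    ultimately have "inf f \<bar>a\<bar> + (f - inf f \<bar>a\<bar>) \<in> I + J" by (rule set_plus_intro)
    then show ?thesis by (simp only: add_diff_eq add_diff_cancel_left')
  qed
  have "f \<in> I + J" if "e \<in> I + J" "\<bar>f\<bar> \<le> \<bar>e\<bar>" for f e
  proof -
    obtain a b where ab: "a \<in> I" "b \<in> J" "e = a + b"
      using \<open>e \<in> I + J\<close> by (rule set_plus_elim)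
    have "\<bar>f\<bar> \<le> \<bar>a\<bar> + \<bar>b\<bar>"
      using \<open>\<bar>f\<bar> \<le> \<bar>e\<bar>\<close> abs_triangle_ineq[of a b] ab by simp
    then have "pprt f \<in> I + J" "pprt (- f) \<in> I + J"
      using pos[OF ab(1,2)] order_trans[OF pprt_le_abs[of f]] order_trans[OF pprt_le_abs[of "- f"]]
      by simp_all
    from subspace_diff[OF sub this] show ?thesis
      using prts[of f] by (simp add: pprt_neg)
  qed
  with sub show ?thesis unfolding order_ideal_def by blast
qed

section \<open>Projection bands from an order dense majorizing sublattice\<close>

text \<open>
  The common core of both parts: it suffices to project within \<open>E\<close>, onto the band generated there by
  a set \<open>G\<close> that determines the disjoint complement of \<open>B\<close>. Leaving \<open>G\<close> open is what allows a
  countable choice when \<open>B\<close> is countably generated.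
\<close>

lemma projection_band_of_sublattice:
  fixes E :: "'a::vector_lattice set"
  assumes arch: "archimedean_lattice (UNIV :: 'a set)"
    and E: "vector_sublattice UNIV E" "order_dense UNIV E" "majorizing UNIV E"
    and B: "band UNIV B"
    and G: "G \<subseteq> B \<inter> E" "disjoint_complement UNIV G \<subseteq> disjoint_complement UNIV B"
    and proj: "projection_band E (band E hull G)"
  shows "projection_band UNIV B"
proof -
  let ?Bd = "disjoint_complement UNIV B"
  let ?D = "band E hull G"
  have idealB: "order_ideal UNIV B" using B by (simp add: band_def)
  have idealBd: "order_ideal UNIV ?Bd"
    using band_disjoint_complement[OF vector_sublattice_UNIV, of B] by (simp add: band_def)
  have "inf \<bar>d\<bar> \<bar>h\<bar> = 0" if "d \<in> ?D" "h \<in> ?Bd" for d h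
  proof (rule ccontr)
    assume "inf \<bar>d\<bar> \<bar>h\<bar> \<noteq> 0"
    then obtain e where e: "e \<in> E" "0 < e" "e \<le> \<bar>d\<bar>" "e \<le> \<bar>h\<bar>"
      by (rule order_dense_not_disjoint[OF E(2)])
    have "e \<in> ?Bd"
      using order_ideal_UNIV_mem[OF idealBd \<open>h \<in> ?Bd\<close>] e by simp
    then have "G \<subseteq> disjoint_complement E {e}"
      using G(1) by (auto simp: disjoint_complement_def inf_commute)
    moreover have "band E (disjoint_complement E {e})"
      using band_disjoint_complement[OF E(1)] e(1) by simp
    ultimately have "?D \<subseteq> disjoint_complement E {e}"
      by (rule hull_minimal)
    with \<open>d \<in> ?D\<close> have "inf \<bar>e\<bar> \<bar>d\<bar> = 0"
      by (auto simp: disjoint_complement_def inf_commute)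
    with e show False using not_disjoint_if_below by blast
  qed
  then have "?D \<subseteq> disjoint_complement UNIV ?Bd"
    by (auto simp: disjoint_complement_def)
  then have "?D \<subseteq> B"
    using double_disjoint_complement_subset_band[OF arch B] by blast
  moreover have "disjoint_complement E ?D \<subseteq> ?Bd"
  proof -
    have "disjoint_complement E ?D \<subseteq> disjoint_complement UNIV G"
      by (auto simp: disjoint_complement_def hull_inc)
    with G(2) show ?thesis by blast
  qed
  ultimately have "E \<subseteq> B + ?Bd"
    using proj set_plus_mono2 unfolding projection_band_def by metis
  then have "order_ideal UNIV hull E \<subseteq> B + ?Bd"
    using order_ideal_sum[OF idealB idealBd] by (rule hull_minimal)
  with E(3) idealB show ?thesis
    unfolding majorizing_def projection_band_def by blast
qed

text \<open>
  Positivity matters because a positive element below \<open>\<bar>c\<bar>\<close> lies in every ideal containing \<open>c\<close>,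
  whereas an arbitrary lower bound of \<open>\<bar>c\<bar>\<close> need not. Passing to positive parts preserves the
  supremum.
\<close>

lemma super_order_dense_pprt:
  fixes E :: "'a::vector_lattice set"
  assumes "vector_sublattice UNIV E" "super_order_dense UNIV E" "0 \<le> f"
  obtains G where "G \<subseteq> E" "countable G" "\<And>g. g \<in> G \<Longrightarrow> 0 \<le> g" "isLub UNIV G f"
proof -
  obtain G where G: "G \<subseteq> E" "countable G" "isLub UNIV G f"
    using assms(2,3) unfolding super_order_dense_def by blast
  have "isUb UNIV (pprt ` G) v \<longleftrightarrow> isUb UNIV G v \<and> (G \<noteq> {} \<longrightarrow> 0 \<le> v)" for v
    by (auto simp: isUb_def setle_def pprt_def)
  then have "isLub UNIV (pprt ` G) f"
    using G(3) \<open>0 \<le> f\<close> by (simp add: isLub_def leastP_def setge_def)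
  moreover have "pprt ` G \<subseteq> E"
    using G(1) vector_sublattice_closed(2)[OF assms(1)] by blast
  ultimately show thesis
    using that[of "pprt ` G"] G(2) by (metis countable_image image_iff zero_le_pprt)
qed

lemma super_order_dense_imp_order_dense:
  fixes E :: "'a::vector_lattice set"
  assumes "vector_sublattice UNIV E" "super_order_dense UNIV E"
  shows "order_dense UNIV E"
  unfolding order_dense_def
proof (intro ballI impI)
  fix f :: 'a assume "0 < f"
  then obtain G where G: "G \<subseteq> E" "\<And>g. g \<in> G \<Longrightarrow> 0 \<le> g" "isLub UNIV G f"
    using super_order_dense_pprt[OF assms, of f] by (metis less_imp_le)
  have "\<not> isUb UNIV G 0"
    using isLub_le_isUb[OF G(3), of 0] \<open>0 < f\<close> by (auto simp: less_le_not_le)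
  then obtain g where "g \<in> G" "\<not> g \<le> 0"
    by (auto simp: isUb_def setle_def)
  then have "0 < g" using G(2)[of g] by (simp add: less_le_not_le)
  then show "\<exists>e\<in>E. 0 < e \<and> e \<le> f"
    using \<open>g \<in> G\<close> G(1) isLubD2[OF G(3)] by blast
qed

lemma PP_of_sublattice:
  fixes E :: "'a::vector_lattice set"
  assumes arch: "archimedean_lattice (UNIV :: 'a set)"
    and E: "vector_sublattice UNIV E" "order_dense UNIV E" "majorizing UNIV E" "PP E"
  shows "PP (UNIV :: 'a set)"
  unfolding PP_def
proof (intro allI impI)
  fix B :: "'a set" assume B: "band UNIV B"
  then have idealB: "order_ideal UNIV B" by (simp add: band_def)
  have "inf \<bar>x\<bar> \<bar>b\<bar> = 0" if x: "x \<in> disjoint_complement UNIV (B \<inter> E)" and "b \<in> B" for x b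
  proof (rule ccontr)
    assume "inf \<bar>x\<bar> \<bar>b\<bar> \<noteq> 0"
    then obtain e where e: "e \<in> E" "0 < e" "e \<le> \<bar>x\<bar>" "e \<le> \<bar>b\<bar>"
      by (rule order_dense_not_disjoint[OF E(2)])
    have "e \<in> B"
      using order_ideal_UNIV_mem[OF idealB \<open>b \<in> B\<close>] e by simp
    with x e(1) have "inf \<bar>e\<bar> \<bar>x\<bar> = 0"
      by (auto simp: disjoint_complement_def inf_commute)
    with e show False using not_disjoint_if_below by blast
  qed
  then have "disjoint_complement UNIV (B \<inter> E) \<subseteq> disjoint_complement UNIV B"
    by (auto simp: disjoint_complement_def)
  moreover have "band E (band E hull (B \<inter> E))"
    using E(1) by (intro band_hull) (auto simp: vector_sublattice_def)
  ultimately show "projection_band UNIV B"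
    using E(4) by (intro projection_band_of_sublattice[OF arch E(1-3) B order_refl])
      (simp_all add: PP_def)
qed

lemma sigma_PP_of_sublattice:
  fixes E :: "'a::vector_lattice set"
  assumes arch: "archimedean_lattice (UNIV :: 'a set)"
    and E: "vector_sublattice UNIV E" "super_order_dense UNIV E" "majorizing UNIV E" "sigma_PP E"
  shows "sigma_PP (UNIV :: 'a set)"
  unfolding sigma_PP_def
proof (intro allI impI)
  fix B :: "'a set" assume "countably_generated_band UNIV B"
  then obtain C where C: "countable C" "B = band UNIV hull C"
    unfolding countably_generated_band_def by blast
  have B: "band UNIV B"
    unfolding C(2) by (rule band_hull) simp_all
  then have idealB: "order_ideal UNIV B" by (simp add: band_def)
  have "\<exists>G\<subseteq>E. countable G \<and> (\<forall>g\<in>G. 0 \<le> g) \<and> isLub UNIV G \<bar>c\<bar>" for c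
    using super_order_dense_pprt[OF E(1,2), of "\<bar>c\<bar>"] by (metis abs_ge_zero)
  then obtain G where G: "G c \<subseteq> E" "countable (G c)" "\<forall>g\<in>G c. 0 \<le> g" "isLub UNIV (G c) \<bar>c\<bar>" for c
    by metis
  let ?G = "\<Union>c\<in>C. G c"
  have "g \<in> B" if "c \<in> C" "g \<in> G c" for c g
  proof -
    have "c \<in> B" using that(1) C(2) by (simp add: hull_inc)
    moreover have "\<bar>g\<bar> \<le> \<bar>c\<bar>"
      using G(3)[of c] isLubD2[OF G(4) that(2)] that(2) by simp
    ultimately show ?thesis
      by (rule order_ideal_UNIV_mem[OF idealB])
  qed
  with G(1) have "?G \<subseteq> B \<inter> E" by blast
  moreover have "disjoint_complement UNIV ?G \<subseteq> disjoint_complement UNIV B"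
  proof
    fix x assume x: "x \<in> disjoint_complement UNIV ?G"
    let ?X = "disjoint_complement UNIV {x}"
    have X: "band UNIV ?X"
      by (rule band_disjoint_complement[OF vector_sublattice_UNIV]) simp
    have "c \<in> ?X" if "c \<in> C" for c
    proof -
      have "G c \<subseteq> ?X"
        using x that by (auto simp: disjoint_complement_def inf_commute)
      then have "\<bar>c\<bar> \<in> ?X"
        using X G(4) unfolding band_def by blast
      then show ?thesis by (simp add: disjoint_complement_def)
    qed
    then have "B \<subseteq> ?X"
      unfolding C(2) by (intro hull_minimal X subsetI)
    then show "x \<in> disjoint_complement UNIV B"
      by (auto simp: disjoint_complement_def inf_commute)
  qed
  moreover have "projection_band E (band E hull ?G)"
  proof -
    have "countable ?G" using C(1) G(2) by simp
    moreover have "?G \<subseteq> E" using G(1) by blast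
    ultimately show ?thesis
      using E(4) unfolding sigma_PP_def countably_generated_band_def by blast
  qed
  ultimately show "projection_band UNIV B"
    by (rule projection_band_of_sublattice[OF arch E(1)
          super_order_dense_imp_order_dense[OF E(1,2)] E(3) B])
qed

theorem corollary3p3:
  assumes "archimedean_lattice (UNIV :: 'a::vector_lattice set)"
  shows "((\<exists>E :: 'a set. vector_sublattice UNIV E \<and> order_dense UNIV E \<and> majorizing UNIV E \<and> PP E)
            \<longrightarrow> PP (UNIV :: 'a set))
       \<and> ((\<exists>E :: 'a set. vector_sublattice UNIV E \<and> super_order_dense UNIV E \<and> majorizing UNIV E \<and> sigma_PP E)
            \<longrightarrow> sigma_PP (UNIV :: 'a set))"
  using PP_of_sublattice[OF assms] sigma_PP_of_sublattice[OF assms] by blast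

end
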